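(* Let $N\ge2$ and consider the one-dimensional inhomogeneous Gaussian mixture model with gaps $\mu_{i+1}-\mu_i=d_i>0$ ($1\le i\le N-1$) and with $i$-th component of standard deviation $\sigma_i$. Suppose that there are constants $s_1,\dots,s_N>0$ and $d>0$ such that $$\frac{d_1}{s_1+s_2}=\frac{d_2}{s_2+s_3}=\cdots=\frac{d_{N-1}}{s_{N-1}+s_N}=d,\qquad \sigma_i=s_i\sigma\quad\text{for all } i\in\{1,\dots,N\}.$$ Let $G_W(\theta;\sigma)\in\mathbb{R}^{(N-1)\times(N-1)}$ be the Wasserstein information matrix of this model. Then for every fixed $\theta$ with $1>\theta_1>\cdots>\theta_{N-1}>0$ and all $1\le i,j\le N-1$, $$\lim_{\sigma\to0}\frac{\big(G_W(\theta;\sigma)\big)_{ij}}{K_{in}(\sigma)}=\delta_{ij}\;g\!\left(\frac{s_{i+1}}{s_i}\right)\left(\frac{s_{i+1}}{p_{i+1}}\right)^{\frac{s_{i+1}}{s_{i+1}+s_i}}\left(\frac{s_i}{p_i}\right)^{\frac{s_i}{s_{i+1}+s_i}}s_i,$$ where $$K_{in}(\sigma)=\frac{\sqrt{2\pi}\,\sigma^3}{d}\,e^{\frac12\left(\frac{d}{\sigma}\right)^2},\qquad g(k)=\int_0^\infty\frac{dy}{1+y^{(k+1)/k}} .$$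
   Context: Model: fix means $\mu_1<\cdots<\mu_N$, and let $\rho_i(x)=\frac{1}{\sqrt{2\pi}\sigma_i}e^{-(x-\mu_i)^2/(2\sigma_i^2)}$, with cumulative distribution function $F_i(x)=\int_{-\infty}^x\rho_i(s)\,ds$. For parameters $\theta$ with $1=\theta_0>\theta_1>\cdots>\theta_{N-1}>\theta_N=0$, the model is $$\rho_\theta=\sum_{i=1}^{N-1}\theta_i(\rho_{i+1}-\rho_i)+\rho_1=\sum_{i=1}^Np_i\rho_i,\qquad p_i=\theta_{i-1}-\theta_i>0.$$ Only $\theta$ varies; the means are fixed. Wasserstein information matrix: the matrix of the pullback to the parameter space of the Wasserstein metric on densities on $\mathbb{R}$, given for this model by $$\big(G_W(\theta;\sigma)\big)_{ij}=\int_{\mathbb{R}}\frac{(F_{i+1}(x)-F_i(x))(F_{j+1}(x)-F_j(x))}{\rho_\theta(x)}\,dx .$$ $\delta_{ij}$ is the Kronecker symbol. *)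

theory Defs
  imports "HOL-Probability.Probability"
begin

text \<open>
  Components are indexed by \<open>1, \<dots>, N\<close>; \<open>\<mu> i\<close> and \<open>sd i\<close> are the mean and the standard deviation of
  the \<open>i\<close>-th one, and \<open>\<theta>\<close> is extended to \<open>0, \<dots>, N\<close> by \<open>\<theta> 0 = 1\<close> and \<open>\<theta> N = 0\<close>. Values at
  other indices are irrelevant.
\<close>

definition mixture_density :: "nat \<Rightarrow> (nat \<Rightarrow> real) \<Rightarrow> (nat \<Rightarrow> real) \<Rightarrow> (nat \<Rightarrow> real) \<Rightarrow> real \<Rightarrow> real" where
  "mixture_density N \<mu> sd \<theta> x =
     (\<Sum>i=1..N-1. \<theta> i * (normal_density (\<mu> (i+1)) (sd (i+1)) x - normal_density (\<mu> i) (sd i) x))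
       + normal_density (\<mu> 1) (sd 1) x"

definition mixture_weight :: "(nat \<Rightarrow> real) \<Rightarrow> nat \<Rightarrow> real" where
  "mixture_weight \<theta> i = \<theta> (i-1) - \<theta> i"

lemma mixture_density_eq_weighted_sum:
  assumes "N \<ge> 1" "\<theta> 0 = 1" "\<theta> N = 0"
  shows "mixture_density N \<mu> sd \<theta> x =
    (\<Sum>i=1..N. mixture_weight \<theta> i * normal_density (\<mu> i) (sd i) x)"
proof -
  define r where "r i = normal_density (\<mu> i) (sd i) x" for i
  have "(\<Sum>i=1..Suc n. (\<theta> (i-1) - \<theta> i) * r i) =
      (\<Sum>i=1..n. \<theta> i * (r (i+1) - r i)) + \<theta> 0 * r 1 - \<theta> (Suc n) * r (Suc n)" for n
    by (induction n) (auto simp: algebra_simps)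
  from this[of "N - 1"] assms show ?thesis
    by (simp add: mixture_density_def mixture_weight_def r_def)
qed

definition gauss_cdf :: "real \<Rightarrow> real \<Rightarrow> real \<Rightarrow> real" where
  "gauss_cdf m s x = (LBINT t:{..x}. normal_density m s t)"

text \<open>
  The entries \<open>(i, j)\<close>, \<open>1 \<le> i, j \<le> N - 1\<close>, of the pullback of the Wasserstein metric. On the line
  this metric is \<open>\<integral> \<partial>\<^sub>i F \<partial>\<^sub>j F / \<rho> dx\<close>, with \<open>F\<close> the distribution function of the density \<open>\<rho>\<close>, and
  here \<open>\<partial>F / \<partial>\<theta> i\<close> is the difference of consecutive component distribution functions.
\<close>

definition wasserstein_info_matrix ::
  "nat \<Rightarrow> (nat \<Rightarrow> real) \<Rightarrow> (nat \<Rightarrow> real) \<Rightarrow> (nat \<Rightarrow> real) \<Rightarrow> nat \<Rightarrow> nat \<Rightarrow> real" where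
  "wasserstein_info_matrix N \<mu> sd \<theta> i j =
     (LBINT x. (gauss_cdf (\<mu> (i+1)) (sd (i+1)) x - gauss_cdf (\<mu> i) (sd i) x)
             * (gauss_cdf (\<mu> (j+1)) (sd (j+1)) x - gauss_cdf (\<mu> j) (sd j) x)
             / mixture_density N \<mu> sd \<theta> x)"

definition K_in :: "real \<Rightarrow> real \<Rightarrow> real" where
  "K_in d \<sigma> = sqrt (2 * pi) * \<sigma> ^ 3 / d * exp ((d / \<sigma>)\<^sup>2 / 2)"

definition g_in :: "real \<Rightarrow> real" where
  "g_in k = (LBINT y:{0..}. 1 / (1 + y powr ((k + 1) / k)))"

end

theory Submission
  imports Defs "HOL-Real_Asymp.Real_Asymp"
begin

text \<open>
  The components \<open>i\<close> and \<open>i + 1\<close> have equal exponents at \<open>c = \<mu> i + d s i = \<mu> (i+1) - d s (i+1)\<close>,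
  and every other component is exponentially smaller there. Rescaling by \<open>x = c + \<sigma>\<^sup>2 v / d\<close> turns
  \<open>sqrt (2 pi) \<sigma> exp ((d / \<sigma>)\<^sup>2 / 2) \<rho>\<^sub>\<theta>\<close> into, in the limit, \<open>a exp (- v / s i) + b exp (v / s (i+1))\<close> with
  \<open>a = p i / s i\<close> and \<open>b = p (i+1) / s (i+1)\<close>, while the difference of the distribution functions
  tends to \<open>-1\<close>. Dominated convergence on the interval between the two means gives the diagonal
  limit, and \<open>y = (b / a) powr (s (i+1) / (s i + s (i+1))) * exp (v / s i)\<close> reduces it to \<open>g_in\<close>.
  Outside that interval the difference of the distribution functions is at most a constant times
  \<open>\<sigma> \<rho>\<^sub>\<theta>\<close> by Gaussian tail bounds; this makes everything else, including the off-diagonal entries,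
  of order \<open>\<sigma>\<close>, which is negligible against \<open>K_in\<close>.
\<close>

subsection \<open>Gaussian tails\<close>

lemma integrable_indicator_normal [simp, intro]:
  "0 < s \<Longrightarrow> A \<in> sets borel \<Longrightarrow> integrable lborel (\<lambda>t. indicator A t * normal_density m s t)"
  using integrable_mult_indicator[of A lborel "normal_density m s"] by simp

lemma gauss_cdf_eq: "gauss_cdf m s x = (\<integral>t. indicator {..x} t * normal_density m s t \<partial>lborel)"
  by (simp add: gauss_cdf_def set_lebesgue_integral_def)

lemma one_minus_gauss_cdf_eq:
  assumes "0 < s"
  shows "1 - gauss_cdf m s x = (\<integral>t. indicator {x<..} t * normal_density m s t \<partial>lborel)"
proof -
  have "gauss_cdf m s x + (\<integral>t. indicator {x<..} t * normal_density m s t \<partial>lborel)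
      = (\<integral>t. indicator {..x} t * normal_density m s t + indicator {x<..} t * normal_density m s t \<partial>lborel)"
    unfolding gauss_cdf_eq using assms by (intro Bochner_Integration.integral_add[symmetric]) auto
  also have "\<dots> = (\<integral>t. normal_density m s t \<partial>lborel)"
    by (intro Bochner_Integration.integral_cong) (auto split: split_indicator)
  finally show ?thesis using assms by simp
qed

lemma gauss_cdf_bounds:
  assumes "0 < s"
  shows "0 \<le> gauss_cdf m s x" "gauss_cdf m s x \<le> 1"
proof -
  show "0 \<le> gauss_cdf m s x"
    unfolding gauss_cdf_eq by (intro integral_nonneg_AE) auto
  have "0 \<le> 1 - gauss_cdf m s x"
    unfolding one_minus_gauss_cdf_eq[OF assms] by (intro integral_nonneg_AE) auto
  then show "gauss_cdf m s x \<le> 1" by simp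
qed

lemma borel_measurable_gauss_cdf [measurable]: "gauss_cdf m s \<in> borel_measurable borel"
  unfolding gauss_cdf_eq[abs_def] normal_density_def by (simp add: indicator_def)

text \<open>Expanding \<open>(t - m)\<^sup>2\<close> about \<open>x\<close> leaves the cross term
  \<open>2 * (t - x) * (x - m)\<close>, which is nonnegative when \<open>t\<close> lies beyond
  \<open>x\<close> as seen from \<open>m\<close>. The factor \<open>sqrt (2 * pi) * s\<close> undoes
  one of the two normalisations on the right.\<close>

lemma gauss_density_split:
  assumes "0 < s" "0 \<le> (t - x) * (x - m)"
  shows "normal_density m s t \<le> sqrt (2 * pi) * s * normal_density m s x * normal_density x s t"
proof -
  have "(x - m)\<^sup>2 + (t - x)\<^sup>2 \<le> (t - m)\<^sup>2"
    using assms(2) by (simp add: power2_eq_square algebra_simps)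
  then have "- (t - m)\<^sup>2 / (2 * s\<^sup>2) \<le> - (x - m)\<^sup>2 / (2 * s\<^sup>2) + - (t - x)\<^sup>2 / (2 * s\<^sup>2)"
    unfolding add_divide_distrib[symmetric] using assms(1) by (intro divide_right_mono) auto
  then have "exp (- (t - m)\<^sup>2 / (2 * s\<^sup>2)) \<le> exp (- (x - m)\<^sup>2 / (2 * s\<^sup>2)) * exp (- (t - x)\<^sup>2 / (2 * s\<^sup>2))"
    by (simp flip: exp_add)
  then show ?thesis
    using assms(1) by (simp add: normal_density_def real_sqrt_mult divide_simps)
qed

text \<open>On the half-line \<open>t \<le> x\<close> the density is dominated by a multiple of the
  Gaussian recentred at \<open>x\<close>, whose total mass is 1. Unlike a Mills-ratio bound there is
  no factor \<open>1 / (m - x)\<close>, so the estimate holds right up to the mean.\<close>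

lemma gauss_cdf_lower_tail:
  assumes "0 < s" "x \<le> m"
  shows "gauss_cdf m s x \<le> sqrt (2 * pi) * s * normal_density m s x"
proof -
  have "gauss_cdf m s x \<le> (\<integral>t. sqrt (2 * pi) * s * normal_density m s x * normal_density x s t \<partial>lborel)"
    unfolding gauss_cdf_eq using assms
    by (intro integral_mono)
       (auto split: split_indicator intro!: gauss_density_split mult_nonpos_nonpos)
  then show ?thesis using assms by simp
qed

lemma gauss_cdf_upper_tail:
  assumes "0 < s" "m \<le> x"
  shows "1 - gauss_cdf m s x \<le> sqrt (2 * pi) * s * normal_density m s x"
proof -
  have "1 - gauss_cdf m s x \<le> (\<integral>t. sqrt (2 * pi) * s * normal_density m s x * normal_density x s t \<partial>lborel)"
    unfolding one_minus_gauss_cdf_eq[OF assms(1)] using assms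
    by (intro integral_mono)
       (auto split: split_indicator intro!: gauss_density_split)
  then show ?thesis using assms by simp
qed

subsection \<open>The limiting integral\<close>

text \<open>The exponential density plus its reflection is
  \<open>l * exp (- l * \<bar>v\<bar>)\<close> off the origin. At \<open>v = 0\<close> both terms
  count, so the sum is used as a majorant rather than as an equal function.\<close>

lemma integrable_exp_neg_abs:
  fixes l :: real
  assumes "0 < l"
  shows "integrable lborel (\<lambda>v. exp (- l * \<bar>v\<bar>))"
proof -
  interpret prob_space "density lborel (exponential_density l)"
    by (rule prob_space_exponential_density) fact
  have "integrable (density lborel (exponential_density l)) (\<lambda>_. 1::real)"
    by simp
  then have E: "integrable lborel (exponential_density l)"
    using assms by (subst (asm) integrable_density) (auto simp: exponential_density_nonneg)
  have "integrable lborel (\<lambda>v. exponential_density l (0 + (-1) * v))"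
    by (rule lborel_integrable_real_affine[OF E]) simp
  with E have "integrable lborel (\<lambda>v. (exponential_density l v + exponential_density l (- v)) / l)"
    by simp
  then show ?thesis
    by (rule Bochner_Integration.integrable_bound)
       (use assms in \<open>auto intro!: AE_I2 simp: exponential_density_def mult_ac\<close>)
qed

text \<open>One summand suffices: the first for \<open>v \<le> 0\<close>, the second otherwise.
  Taking minima of coefficients and rates makes the minorant symmetric in \<open>v\<close>, and its
  reciprocal is integrable.\<close>

lemma exp_sum_ge:
  fixes a b k l :: real
  assumes "0 < a" "0 < b" "0 < k" "0 < l"
  shows "min a b * exp (min k l * \<bar>v\<bar>) \<le> a * exp (- k * v) + b * exp (l * v)"
proof (cases "v \<le> 0")
  case True
  have "min a b * exp (min k l * \<bar>v\<bar>) \<le> a * exp (k * \<bar>v\<bar>)"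
    using assms by (intro mult_mono) (auto intro!: mult_right_mono)
  with True assms show ?thesis by (simp add: add_increasing2)
next
  case False
  have "min a b * exp (min k l * \<bar>v\<bar>) \<le> b * exp (l * \<bar>v\<bar>)"
    using assms by (intro mult_mono) (auto intro!: mult_right_mono)
  with False assms show ?thesis by (simp add: add_increasing)
qed

lemma integrable_inverse_exp_sum:
  fixes a b k l :: real
  assumes "0 < a" "0 < b" "0 < k" "0 < l"
  shows "integrable lborel (\<lambda>v. 1 / (a * exp (- k * v) + b * exp (l * v)))"
proof (rule Bochner_Integration.integrable_bound)
  show "integrable lborel (\<lambda>v. exp (- min k l * \<bar>v\<bar>) / min a b)"
    using assms by (intro integrable_divide integrable_exp_neg_abs) auto
  show "AE v in lborel. norm (1 / (a * exp (- k * v) + b * exp (l * v)))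
      \<le> norm (exp (- min k l * \<bar>v\<bar>) / min a b)"
  proof (rule AE_I2)
    fix v
    have pos: "0 < a * exp (- k * v) + b * exp (l * v)"
      using assms by (simp add: add_pos_pos)
    have "1 / (a * exp (- k * v) + b * exp (l * v)) \<le> 1 / (min a b * exp (min k l * \<bar>v\<bar>))"
      using assms by (intro divide_left_mono exp_sum_ge mult_pos_pos pos) auto
    also have "\<dots> = exp (- min k l * \<bar>v\<bar>) / min a b"
      by (simp add: exp_minus field_simps)
    finally show "norm (1 / (a * exp (- k * v) + b * exp (l * v)))
      \<le> norm (exp (- min k l * \<bar>v\<bar>) / min a b)"
      using pos assms by simp
  qed
qed measurable

lemma integral_inverse_exp_sum:
  fixes a b p q :: real
  assumes "0 < a" "0 < b" "0 < p" "0 < q"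
  shows "(\<integral>v. 1 / (a * exp (- (v / p)) + b * exp (v / q)) \<partial>lborel)
    = g_in (q / p) * (1 / b) powr (q / (q + p)) * (1 / a) powr (p / (q + p)) * p"
proof -
  \<comment> \<open>This is the exponent in \<open>g_in (q / p)\<close>. It equals
    \<open>1 + p / q\<close>, so \<open>exp (v / p) powr \<kappa>\<close> factors as
    \<open>exp (v / p) * exp (v / q)\<close>.\<close>
  define \<kappa> where "\<kappa> = (q / p + 1) / (q / p)"
  have \<kappa>: "\<kappa> = p * (1 / p + 1 / q)" "0 < \<kappa>" "1 / \<kappa> = q / (q + p)"
    using assms by (auto simp: \<kappa>_def add_pos_pos divide_simps)
  \<comment> \<open>Chosen so that \<open>(c * exp (v / p)) powr \<kappa>\<close> carries the factor
    \<open>b / a\<close>, matching the coefficients of the denominator.\<close>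
  define c where "c = (b / a) powr (1 / \<kappa>)"
  have c: "c powr \<kappa> = b / a" "0 < c"
  proof -
    have "1 / \<kappa> * \<kappa> = 1" using \<kappa>(2) by simp
    then show "c powr \<kappa> = b / a" "0 < c"
      using assms unfolding c_def powr_powr by auto
  qed
  define f where "f = (\<lambda>y. 1 / (1 + y powr \<kappa>))"
  define g where "g = (\<lambda>v. c * exp (v / p))"
  define g' where "g' = (\<lambda>v. c * exp (v / p) / p)"
  have fg: "f (g v) * g' v = a * c / p * (1 / (a * exp (- (v / p)) + b * exp (v / q)))" for v
  proof -
    have "g v powr \<kappa> = b / a * exp (v / p) powr \<kappa>"
      using c by (simp add: g_def powr_mult)
    also have "exp (v / p) powr \<kappa> = exp (v / p) * exp (v / q)"
      using assms by (simp add: powr_def \<kappa>(1) field_simps flip: exp_add)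
    finally have "1 + g v powr \<kappa> = (a + b * exp (v / p) * exp (v / q)) / a"
      using assms by (simp add: add_divide_distrib)
    then have "f (g v) = a / (a + b * exp (v / p) * exp (v / q))"
      by (simp add: f_def)
    also have "\<dots> = a * exp (- (v / p)) / (a * exp (- (v / p)) + b * exp (v / q))"
    proof -
      have "a * exp (- (v / p)) + b * exp (v / q) = (a + b * exp (v / p) * exp (v / q)) * exp (- (v / p))"
        by (simp add: algebra_simps flip: exp_add)
      then show ?thesis by simp
    qed
    finally show ?thesis
      using assms by (simp add: g'_def exp_minus mult_ac)
  qed
  have int: "integrable lborel (\<lambda>v. f (g v) * g' v)"
    unfolding fg using integrable_inverse_exp_sum[of a b "1/p" "1/q"] assms
    by (intro integrable_mult_right) (simp add: mult.commute)
  \<comment> \<open>\<open>g\<close> maps the line increasingly onto the open half-line, hence the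
    limits 0 and \<infinity> at its two ends.\<close>
  have subst: "(LBINT y=0..\<infinity>. f y) = (LBINT v=-\<infinity>..\<infinity>. f (g v) * g' v)"
  proof (rule interval_integral_substitution_nonneg)
    show "DERIV g v :> g' v" for v
      unfolding g_def g'_def using assms by (auto intro!: derivative_eq_intros)
    show "isCont f (g v)" for v
    proof -
      have "0 < g v" using c by (simp add: g_def)
      moreover have "1 + g v powr \<kappa> \<noteq> 0" using powr_ge_zero[of "g v" \<kappa>] by linarith
      ultimately show ?thesis unfolding f_def by (intro continuous_intros) auto
    qed
    show "isCont g' v" for v unfolding g'_def using assms by (intro continuous_intros) auto
    show "0 \<le> f (g v)" for v by (simp add: f_def)
    show "0 \<le> g' v" for v using c assms by (simp add: g'_def)
    have "(g \<longlongrightarrow> 0) at_bot" unfolding g_def using assms c by real_asymp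
    then show "((ereal \<circ> g \<circ> real_of_ereal) \<longlongrightarrow> 0) (at_right (-\<infinity>))"
      unfolding zero_ereal_def ereal_tendsto_simps .
    have "filterlim g at_top at_top" unfolding g_def using assms c by real_asymp
    then show "((ereal \<circ> g \<circ> real_of_ereal) \<longlongrightarrow> \<infinity>) (at_left \<infinity>)"
      by (simp add: ereal_tendsto_simps)
    show "set_integrable lborel (einterval (-\<infinity>) \<infinity>) (\<lambda>v. f (g v) * g' v)"
      using int by (simp add: set_integrable_def)
  qed simp
  have Ioi: "(LBINT y=0..\<infinity>. f y) = (LBINT y:{0<..}. f y)"
    unfolding zero_ereal_def interval_integral_to_infinity_eq ..
  have whole: "(LBINT v=-\<infinity>..\<infinity>. f (g v) * g' v)
      = a * c / p * (\<integral>v. 1 / (a * exp (- (v / p)) + b * exp (v / q)) \<partial>lborel)"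
    unfolding fg interval_lebesgue_integral_def set_lebesgue_integral_def
    by (simp del: times_divide_eq_left times_divide_eq_right)
  \<comment> \<open>\<open>g_in\<close> integrates over the closed half-line and the substitution
    reaches the open one; they differ by the null set of the origin.\<close>
  have g_in: "g_in (q / p) = (LBINT y:{0<..}. f y)"
    unfolding g_in_def f_def \<kappa>_def
  proof (rule set_integral_cong_set)
    show "AE y in lborel. y \<in> {0<..} \<longleftrightarrow> y \<in> {0::real..}"
      using AE_lborel_singleton[of "0::real"] by eventually_elim auto
  qed (simp_all add: set_borel_measurable_def)
  \<comment> \<open>The two exponents add up to 1, so \<open>1 / a\<close> splits into its powers
    \<open>p / (q + p)\<close> and \<open>q / (q + p)\<close>; the latter is absorbed into
    \<open>1 / c\<close>.\<close>
  have const: "1 / (a * c) = (1 / b) powr (q / (q + p)) * (1 / a) powr (p / (q + p))"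
  proof -
    have "p / (q + p) = 1 - q / (q + p)" using assms by (simp add: field_simps)
    then have "(1 / b) powr (q / (q + p)) * (1 / a) powr (p / (q + p))
       = (1 / b) powr (1 / \<kappa>) * ((1 / a) / (1 / a) powr (1 / \<kappa>))"
      using assms \<kappa> by (simp add: powr_diff)
    also have "\<dots> = 1 / (a * c)"
      using assms by (simp add: c_def powr_divide)
    finally show ?thesis by simp
  qed
  have "g_in (q / p) = a * c / p * (\<integral>v. 1 / (a * exp (- (v / p)) + b * exp (v / q)) \<partial>lborel)"
    unfolding g_in Ioi[symmetric] subst whole ..
  then have "(\<integral>v. 1 / (a * exp (- (v / p)) + b * exp (v / q)) \<partial>lborel) = g_in (q / p) * (1 / (a * c)) * p"
    using assms c by simp
  then show ?thesis
    unfolding const by (simp only: mult.assoc)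
qed

subsection \<open>Rescaled Gaussian densities\<close>

text \<open>Expand the square about \<open>c\<close>. The scale \<open>\<sigma>\<^sup>2\<close> of
  the displacement makes the linear term free of \<sigma>, the prefactor contributes
  \<open>d\<^sup>2\<close> to the constant term, and the quadratic term fades as \<sigma> tends to
  0. Comparing \<open>\<bar>c - m\<bar>\<close> with \<open>d * s\<close> therefore decides the
  limit.\<close>

lemma scaled_normal_density:
  fixes \<sigma> d s m c v :: real
  assumes "0 < \<sigma>" "0 < d" "0 < s"
  shows "sqrt (2 * pi) * \<sigma> * exp ((d / \<sigma>)\<^sup>2 / 2) * normal_density m (s * \<sigma>) (c + \<sigma>\<^sup>2 / d * v)
    = 1 / s * exp ((d\<^sup>2 - ((c - m) / s)\<^sup>2) / (2 * \<sigma>\<^sup>2) - (c - m) * v / (d * s\<^sup>2) - \<sigma>\<^sup>2 * v\<^sup>2 / (2 * d\<^sup>2 * s\<^sup>2))"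
proof -
  have "(d / \<sigma>)\<^sup>2 / 2 + - (c + \<sigma>\<^sup>2 / d * v - m)\<^sup>2 / (2 * (s * \<sigma>)\<^sup>2)
    = (d\<^sup>2 - ((c - m) / s)\<^sup>2) / (2 * \<sigma>\<^sup>2) - (c - m) * v / (d * s\<^sup>2) - \<sigma>\<^sup>2 * v\<^sup>2 / (2 * d\<^sup>2 * s\<^sup>2)"
    using assms by (simp add: field_simps power2_eq_square)
  then show ?thesis
    using assms unfolding normal_density_def by (simp add: real_sqrt_mult field_simps flip: exp_add)
qed

text \<open>At this critical distance the term in \<open>1 / \<sigma>\<^sup>2\<close> cancels
  exactly and only the linear exponent survives. Its sign records on which side of the mean
  \<open>c\<close> lies.\<close>

lemma tendsto_scaled_normal_density:
  fixes d s m c v :: real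
  assumes "0 < d" "0 < s" "\<bar>c - m\<bar> = d * s"
  shows "((\<lambda>\<sigma>. sqrt (2 * pi) * \<sigma> * exp ((d / \<sigma>)\<^sup>2 / 2) * normal_density m (s * \<sigma>) (c + \<sigma>\<^sup>2 / d * v))
    \<longlongrightarrow> 1 / s * exp (- (sgn (c - m) * v / s))) (at_right 0)"
proof -
  have "(c - m)\<^sup>2 = (d * s)\<^sup>2"
    using assms(3) by (metis power2_abs)
  then have sq: "((c - m) / s)\<^sup>2 = d\<^sup>2"
    using assms by (simp add: power_divide power_mult_distrib)
  have "c - m = sgn (c - m) * (d * s)"
    using sgn_mult_abs[of "c - m"] assms(3) by simp
  then have "(c - m) * v / (d * s\<^sup>2) = sgn (c - m) * (d * s) * v / (d * s\<^sup>2)"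
    by (rule arg_cong[where f="\<lambda>u. u * v / (d * s\<^sup>2)"])
  then have lin: "(c - m) * v / (d * s\<^sup>2) = sgn (c - m) * v / s"
    using assms(1,2) by (simp add: power2_eq_square)
  define e where "e = sgn (c - m) * v / s"
  define q where "q = v\<^sup>2 / (2 * d\<^sup>2 * s\<^sup>2)"
  have "((\<lambda>\<sigma>. 1 / s * exp (- e - \<sigma>\<^sup>2 * q)) \<longlongrightarrow> 1 / s * exp (- e - 0\<^sup>2 * q)) (at_right 0)"
    by (intro tendsto_intros)
  then have "((\<lambda>\<sigma>. 1 / s * exp (- e - \<sigma>\<^sup>2 * q)) \<longlongrightarrow> 1 / s * exp (- e)) (at_right 0)"
    by simp
  then show ?thesis
    unfolding e_def
  proof (rule Lim_transform_eventually)
    show "\<forall>\<^sub>F \<sigma> in at_right 0. 1 / s * exp (- (sgn (c - m) * v / s) - \<sigma>\<^sup>2 * q) =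
        sqrt (2 * pi) * \<sigma> * exp ((d / \<sigma>)\<^sup>2 / 2) * normal_density m (s * \<sigma>) (c + \<sigma>\<^sup>2 / d * v)"
      using eventually_at_right_less
    proof eventually_elim
      case (elim \<sigma>)
      show ?case
        unfolding scaled_normal_density[OF elim assms(1,2)] sq lin q_def by simp
    qed
  qed
qed

text \<open>Beyond the critical distance the constant term is a negative multiple of
  \<open>1 / \<sigma>\<^sup>2\<close>, which outweighs the bounded linear term.\<close>

lemma tendsto_scaled_normal_density_0:
  fixes d s m c v :: real
  assumes "0 < d" "0 < s" "d * s < \<bar>c - m\<bar>"
  shows "((\<lambda>\<sigma>. sqrt (2 * pi) * \<sigma> * exp ((d / \<sigma>)\<^sup>2 / 2) * normal_density m (s * \<sigma>) (c + \<sigma>\<^sup>2 / d * v))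
    \<longlongrightarrow> 0) (at_right 0)"
proof -
  have "d < \<bar>(c - m) / s\<bar>"
    using assms by (simp add: field_simps)
  then have "d\<^sup>2 < \<bar>(c - m) / s\<bar>\<^sup>2"
    using assms(1) by (intro power_strict_mono) auto
  then have "d\<^sup>2 < ((c - m) / s)\<^sup>2"
    by (simp only: power2_abs)
  then have K: "d\<^sup>2 - ((c - m) / s)\<^sup>2 < 0" by simp
  define K where "K = d\<^sup>2 - ((c - m) / s)\<^sup>2"
  define e where "e = (c - m) * v / (d * s\<^sup>2)"
  define q where "q = v\<^sup>2 / (2 * d\<^sup>2 * s\<^sup>2)"
  have "((\<lambda>\<sigma>. 1 / s * exp (K / (2 * \<sigma>\<^sup>2) - e)) \<longlongrightarrow> 0) (at_right 0)"
    using K assms unfolding K_def[symmetric] by real_asymp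
  then have "((\<lambda>\<sigma>. 1 / s * exp (K / (2 * \<sigma>\<^sup>2) - e) * exp (- (\<sigma>\<^sup>2 * q)))
      \<longlongrightarrow> 0 * exp (- (0\<^sup>2 * q))) (at_right 0)"
    by (rule tendsto_mult) (intro tendsto_intros)
  then have "((\<lambda>\<sigma>. 1 / s * exp (K / (2 * \<sigma>\<^sup>2) - e) * exp (- (\<sigma>\<^sup>2 * q))) \<longlongrightarrow> 0) (at_right 0)"
    by simp
  then show ?thesis
  proof (rule Lim_transform_eventually)
    show "\<forall>\<^sub>F \<sigma> in at_right 0. 1 / s * exp (K / (2 * \<sigma>\<^sup>2) - e) * exp (- (\<sigma>\<^sup>2 * q)) =
        sqrt (2 * pi) * \<sigma> * exp ((d / \<sigma>)\<^sup>2 / 2) * normal_density m (s * \<sigma>) (c + \<sigma>\<^sup>2 / d * v)"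
      using eventually_at_right_less
    proof eventually_elim
      case (elim \<sigma>)
      show ?case
        unfolding scaled_normal_density[OF elim assms(1,2)] q_def K_def e_def by (simp flip: exp_add)
    qed
  qed
qed

text \<open>
  For \<open>u = \<bar>v\<bar>\<close> the side condition says that \<open>x\<close> has not passed the mean of the dominant component:
  the quadratic term then eats at most half of the linear exponent, which yields the dominating function.
\<close>

lemma half_exponent_bound:
  fixes \<sigma> d s u :: real
  assumes "0 < d" "0 < s" "0 \<le> u" "\<sigma>\<^sup>2 / d * u \<le> d * s"
  shows "u / (2 * s) \<le> u / s - \<sigma>\<^sup>2 * u\<^sup>2 / (2 * d\<^sup>2 * s\<^sup>2)"
proof -
  have "\<sigma>\<^sup>2 * u\<^sup>2 / (2 * d\<^sup>2 * s\<^sup>2) = (\<sigma>\<^sup>2 / d * u) * (u / (2 * d * s\<^sup>2))"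
    by (simp add: power2_eq_square)
  also have "\<dots> \<le> (d * s) * (u / (2 * d * s\<^sup>2))"
    using assms by (intro mult_right_mono) auto
  also have "\<dots> = u / (2 * s)"
    using assms by (simp add: power2_eq_square)
  finally show ?thesis using assms by (simp add: field_simps)
qed

subsection \<open>The mixture away from the gaps\<close>

text \<open>Geometrically, \<open>gap\<close> says that the intervals of radius
  \<open>d * s k\<close> about the means are laid end to end. The monotonicity of \<theta>,
  including its end values, makes every weight positive.\<close>

locale gaussian_mixture =
  fixes N :: nat and \<mu> s \<theta> :: "nat \<Rightarrow> real" and d :: real
  assumes N_pos: "1 \<le> N"
    and s_pos: "\<And>i. i \<in> {1..N} \<Longrightarrow> 0 < s i"
    and d_pos: "0 < d"
    and gap: "\<And>i. i \<in> {1..N-1} \<Longrightarrow> \<mu> (i+1) - \<mu> i = d * (s i + s (i+1))"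
    and theta_0: "\<theta> 0 = 1"
    and theta_N: "\<theta> N = 0"
    and theta_decr: "\<And>i. i \<in> {1..N} \<Longrightarrow> \<theta> i < \<theta> (i-1)"
begin

abbreviation p :: "nat \<Rightarrow> real" where "p \<equiv> mixture_weight \<theta>"

definition \<rho> :: "real \<Rightarrow> real \<Rightarrow> real" where
  "\<rho> \<sigma> = mixture_density N \<mu> (\<lambda>k. s k * \<sigma>) \<theta>"

definition dF :: "real \<Rightarrow> nat \<Rightarrow> real \<Rightarrow> real" where
  "dF \<sigma> k x = gauss_cdf (\<mu> (k+1)) (s (k+1) * \<sigma>) x - gauss_cdf (\<mu> k) (s k * \<sigma>) x"

text \<open>Open, so that neighbouring gaps, which share a mean as endpoint, are disjoint.\<close>

definition gap_interval :: "nat \<Rightarrow> real set" where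
  "gap_interval k = {\<mu> k<..<\<mu> (k+1)}"

text \<open>Each summand is the price of replacing one component density by \<rho> in its tail
  bound, using that \<open>p l\<close> times that density is at most \<rho>.\<close>

definition tail_const :: "nat \<Rightarrow> real" where
  "tail_const k = sqrt (2 * pi) * (s k / p k + s (k+1) / p (k+1))"

lemma p_pos: "k \<in> {1..N} \<Longrightarrow> 0 < p k"
  using theta_decr by (simp add: mixture_weight_def)

lemma \<rho>_eq: "\<rho> \<sigma> x = (\<Sum>k=1..N. p k * normal_density (\<mu> k) (s k * \<sigma>) x)"
  unfolding \<rho>_def using N_pos theta_0 theta_N by (rule mixture_density_eq_weighted_sum)

lemma borel_measurable_\<rho> [measurable]: "\<rho> \<sigma> \<in> borel_measurable borel"
  unfolding \<rho>_eq[abs_def] by measurable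

lemma borel_measurable_dF [measurable]: "dF \<sigma> k \<in> borel_measurable borel"
  unfolding dF_def[abs_def] by measurable

lemma \<rho>_ge: "0 < \<sigma> \<Longrightarrow> k \<in> {1..N} \<Longrightarrow> p k * normal_density (\<mu> k) (s k * \<sigma>) x \<le> \<rho> \<sigma> x"
  unfolding \<rho>_eq
  by (rule member_le_sum[where f="\<lambda>k. p k * normal_density (\<mu> k) (s k * \<sigma>) x"])
     (auto intro!: mult_nonneg_nonneg less_imp_le[OF p_pos])

lemma \<rho>_pos:
  assumes "0 < \<sigma>"
  shows "0 < \<rho> \<sigma> x"
proof -
  have "0 < p 1 * normal_density (\<mu> 1) (s 1 * \<sigma>) x"
    using assms p_pos[of 1] s_pos[of 1] N_pos by (intro mult_pos_pos normal_density_pos) auto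
  also have "\<dots> \<le> \<rho> \<sigma> x" using assms N_pos by (intro \<rho>_ge) auto
  finally show ?thesis .
qed

lemma integrable_\<rho>: "0 < \<sigma> \<Longrightarrow> integrable lborel (\<rho> \<sigma>)"
  unfolding \<rho>_eq[abs_def] using s_pos by (intro Bochner_Integration.integrable_sum integrable_mult_right integrable_normal_density) auto

lemma integral_\<rho>:
  assumes "0 < \<sigma>"
  shows "(\<integral>x. \<rho> \<sigma> x \<partial>lborel) = (\<Sum>k=1..N. p k)"
proof -
  have "(\<integral>x. \<rho> \<sigma> x \<partial>lborel) = (\<Sum>k=1..N. \<integral>x. p k * normal_density (\<mu> k) (s k * \<sigma>) x \<partial>lborel)"
    unfolding \<rho>_eq using assms s_pos by (intro Bochner_Integration.integral_sum integrable_mult_right integrable_normal_density) auto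
  then show ?thesis using assms s_pos by simp
qed

lemma component_indices:
  assumes "k \<in> {1..N-1}"
  shows "k \<in> {1..N}" "k + 1 \<in> {1..N}"
  using assms by auto

lemma tail_const_nonneg: "k \<in> {1..N-1} \<Longrightarrow> 0 \<le> tail_const k"
  using p_pos[of k] p_pos[of "k+1"] s_pos[of k] s_pos[of "k+1"] component_indices[of k]
  by (simp add: tail_const_def)

lemma mean_less: "k \<in> {1..N-1} \<Longrightarrow> \<mu> k < \<mu> (k+1)"
  using gap[of k] mult_pos_pos[OF d_pos add_pos_pos[OF s_pos[of k] s_pos[of "k+1"]]]
    component_indices[of k] by simp

text \<open>For neighbours this is equality in \<open>gap\<close>; each component \<open>k\<close>
  passed on the way adds the width \<open>2 * d * s k\<close> of its interval.\<close>

lemma mean_sep: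
  assumes "1 \<le> i" "i < k" "k \<le> N"
  shows "\<mu> i + d * s i \<le> \<mu> k - d * s k"
  using assms(2,3)
proof (induction k)
  case (Suc k)
  have g: "\<mu> (k+1) - \<mu> k = d * (s k + s (k+1))" using gap[of k] Suc.prems assms(1) by auto
  show ?case
  proof (cases "i = k")
    case True
    with g show ?thesis by (simp add: algebra_simps)
  next
    case False
    with Suc have "\<mu> i + d * s i \<le> \<mu> k - d * s k" by simp
    moreover have "0 < d * s k" using d_pos s_pos[of k] Suc.prems assms(1) by (intro mult_pos_pos) auto
    ultimately show ?thesis using g by (simp add: algebra_simps)
  qed
qed simp

lemma gap_interval_disjoint:
  assumes "i \<in> {1..N-1}" "j \<in> {1..N-1}" "i < j"
  shows "gap_interval i \<inter> gap_interval j = {}"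
proof -
  have "\<mu> (i+1) \<le> \<mu> j"
  proof (cases "i + 1 = j")
    case False
    have "0 < d * s (i+1)" "0 < d * s j" using assms d_pos s_pos by (auto intro!: mult_pos_pos)
    moreover have "\<mu> (i+1) + d * s (i+1) \<le> \<mu> j - d * s j"
      using assms False by (intro mean_sep) auto
    ultimately show ?thesis by linarith
  qed simp
  then show ?thesis by (auto simp: gap_interval_def)
qed

lemma abs_dF_le_1: "0 < \<sigma> \<Longrightarrow> k \<in> {1..N-1} \<Longrightarrow> \<bar>dF \<sigma> k x\<bar> \<le> 1"
  using gauss_cdf_bounds[of "s k * \<sigma>" "\<mu> k" x] gauss_cdf_bounds[of "s (k+1) * \<sigma>" "\<mu> (k+1)" x]
    s_pos[of k] s_pos[of "k+1"] by (auto simp: dF_def)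

text \<open>Left of both means both distribution functions are lower tails; right of both, their
  complements are upper tails. Each tail is controlled by its own component density, hence by
  \<rho>, so the small denominator of the integrand can be cancelled.\<close>

lemma abs_dF_outside:
  assumes "0 < \<sigma>" "k \<in> {1..N-1}" "x \<notin> gap_interval k"
  shows "\<bar>dF \<sigma> k x\<bar> \<le> tail_const k * \<sigma> * \<rho> \<sigma> x"
proof -
  have component: "sqrt (2 * pi) * (s l * \<sigma>) * normal_density (\<mu> l) (s l * \<sigma>) x
      \<le> sqrt (2 * pi) * (s l / p l) * \<sigma> * \<rho> \<sigma> x" if "l \<in> {1..N}" for l
  proof -
    have "sqrt (2 * pi) * (s l / p l) * \<sigma> * (p l * normal_density (\<mu> l) (s l * \<sigma>) x)
      \<le> sqrt (2 * pi) * (s l / p l) * \<sigma> * \<rho> \<sigma> x"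
      using that assms s_pos[of l] p_pos[of l] by (intro mult_left_mono \<rho>_ge) auto
    then show ?thesis using p_pos[OF that] by simp
  qed
  have sk: "0 < s k * \<sigma>" "0 < s (k+1) * \<sigma>" using assms s_pos by auto
  have kN: "k \<in> {1..N}" "k + 1 \<in> {1..N}" using assms by auto
  define T where "T l = sqrt (2 * pi) * (s l * \<sigma>) * normal_density (\<mu> l) (s l * \<sigma>) x" for l
  have "\<bar>dF \<sigma> k x\<bar> \<le> T k + T (k+1)"
  proof (cases "x \<le> \<mu> k")
    case True
    then have "x \<le> \<mu> (k+1)" using mean_less assms by fastforce
    then show ?thesis
      using gauss_cdf_lower_tail[OF sk(1) True] gauss_cdf_lower_tail[OF sk(2), of x "\<mu> (k+1)"]
        gauss_cdf_bounds(1)[OF sk(1), of "\<mu> k" x] gauss_cdf_bounds(1)[OF sk(2), of "\<mu> (k+1)" x]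
      unfolding dF_def T_def by linarith
  next
    case False
    then have x: "\<mu> (k+1) \<le> x" using assms by (auto simp: gap_interval_def)
    then have "\<mu> k \<le> x" using mean_less assms by fastforce
    then show ?thesis
      using gauss_cdf_upper_tail[OF sk(1), of "\<mu> k" x] gauss_cdf_upper_tail[OF sk(2) x]
        gauss_cdf_bounds(2)[OF sk(1), of "\<mu> k" x] gauss_cdf_bounds(2)[OF sk(2), of "\<mu> (k+1)" x]
      unfolding dF_def T_def by linarith
  qed
  also have "\<dots> \<le> tail_const k * \<sigma> * \<rho> \<sigma> x"
    using component[OF kN(1)] component[OF kN(2)] by (simp add: T_def tail_const_def algebra_simps)
  finally show ?thesis .
qed

section \<open>The integrand off the common part of two gaps\<close>

definition integrand :: "nat \<Rightarrow> nat \<Rightarrow> real \<Rightarrow> real \<Rightarrow> real" where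
  "integrand i j \<sigma> x = dF \<sigma> i x * dF \<sigma> j x / \<rho> \<sigma> x"

lemma borel_measurable_integrand [measurable]: "integrand i j \<sigma> \<in> borel_measurable borel"
  unfolding integrand_def[abs_def] by measurable

lemma wasserstein_info_matrix_eq:
  "wasserstein_info_matrix N \<mu> (\<lambda>k. s k * \<sigma>) \<theta> i j = (\<integral>x. integrand i j \<sigma> x \<partial>lborel)"
  by (simp add: wasserstein_info_matrix_def integrand_def dF_def \<rho>_def)

text \<open>Such a point misses at least one gap. If it misses both, the two factors supply
  \<open>\<rho>\<^sup>2\<close> and one \<rho> remains after division. If it misses only one, the
  other factor is bounded by 1 and the single \<rho> cancels, leaving a constant on a bounded
  interval. The majorant adds up all cases.\<close>

lemma abs_integrand_outside:
  assumes "0 < \<sigma>" "i \<in> {1..N-1}" "j \<in> {1..N-1}" "x \<notin> gap_interval i \<inter> gap_interval j"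
  shows "\<bar>integrand i j \<sigma> x\<bar> \<le> tail_const i * tail_const j * \<sigma>\<^sup>2 * \<rho> \<sigma> x
    + (tail_const i * \<sigma> * indicator (gap_interval j) x + tail_const j * \<sigma> * indicator (gap_interval i) x)"
    (is "_ \<le> ?A + (?B + ?C)")
proof -
  note [simp] = \<rho>_pos[OF assms(1), of x, THEN less_imp_le]
  have nn: "0 \<le> ?A" "0 \<le> ?B" "0 \<le> ?C"
    using assms tail_const_nonneg by (auto intro!: mult_nonneg_nonneg)
  have *: "\<bar>dF \<sigma> i x\<bar> * \<bar>dF \<sigma> j x\<bar> \<le> (?A + (?B + ?C)) * \<rho> \<sigma> x"
  proof -
    consider "x \<notin> gap_interval i" "x \<notin> gap_interval j" | "x \<notin> gap_interval i" "x \<in> gap_interval j"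
      | "x \<in> gap_interval i" "x \<notin> gap_interval j" using assms(4) by blast
    then have "\<bar>dF \<sigma> i x\<bar> * \<bar>dF \<sigma> j x\<bar> \<le> ?A * \<rho> \<sigma> x + (?B * \<rho> \<sigma> x + ?C * \<rho> \<sigma> x)"
    proof cases
      case 1
      have "\<bar>dF \<sigma> i x\<bar> * \<bar>dF \<sigma> j x\<bar> \<le> (tail_const i * \<sigma> * \<rho> \<sigma> x) * (tail_const j * \<sigma> * \<rho> \<sigma> x)"
        using assms 1 tail_const_nonneg by (intro mult_mono abs_dF_outside) auto
      then show ?thesis using 1 by (simp add: power2_eq_square mult_ac)
    next
      case 2
      have "\<bar>dF \<sigma> i x\<bar> * \<bar>dF \<sigma> j x\<bar> \<le> (tail_const i * \<sigma> * \<rho> \<sigma> x) * 1"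
        using assms 2 tail_const_nonneg by (intro mult_mono abs_dF_outside abs_dF_le_1) auto
      moreover have "0 \<le> ?A * \<rho> \<sigma> x" using nn by simp
      ultimately show ?thesis using 2 by simp
    next
      case 3
      have "\<bar>dF \<sigma> i x\<bar> * \<bar>dF \<sigma> j x\<bar> \<le> 1 * (tail_const j * \<sigma> * \<rho> \<sigma> x)"
        using assms 3 tail_const_nonneg by (intro mult_mono abs_dF_outside abs_dF_le_1) auto
      moreover have "0 \<le> ?A * \<rho> \<sigma> x" using nn by simp
      ultimately show ?thesis using 3 by simp
    qed
    then show ?thesis by (simp add: distrib_right)
  qed
  then show ?thesis
    using \<rho>_pos[OF assms(1), of x] by (simp add: integrand_def abs_mult pos_divide_le_eq)
qed

lemma outside_integral:
  assumes "i \<in> {1..N-1}" "j \<in> {1..N-1}"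
  defines "f \<equiv> \<lambda>\<sigma> x. indicator (- (gap_interval i \<inter> gap_interval j)) x * integrand i j \<sigma> x"
  shows "0 < \<sigma> \<Longrightarrow> integrable lborel (f \<sigma>)"
    and "((\<lambda>\<sigma>. (\<integral>x. f \<sigma> x \<partial>lborel) / K_in d \<sigma>) \<longlongrightarrow> 0) (at_right 0)"
proof -
  define w where "w \<sigma> x = tail_const i * tail_const j * \<sigma>\<^sup>2 * \<rho> \<sigma> x
    + (tail_const i * \<sigma> * indicator (gap_interval j) x + tail_const j * \<sigma> * indicator (gap_interval i) x)" for \<sigma> x
  \<comment> \<open>\<open>P\<close> collects the total mass of \<rho> and \<open>Q\<close> the
    lengths of the gaps, so that the majorant integrates to
    \<open>P * \<sigma>\<^sup>2 + Q * \<sigma>\<close>.\<close>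
  define P where "P = tail_const i * tail_const j * (\<Sum>k=1..N. p k)"
  define Q where "Q = tail_const i * (\<mu> (j+1) - \<mu> j) + tail_const j * (\<mu> (i+1) - \<mu> i)"
  have [measurable]: "gap_interval k \<in> sets borel" for k by (simp add: gap_interval_def)
  have [measurable]: "f \<sigma> \<in> borel_measurable borel" for \<sigma>
    unfolding f_def by measurable
  have gi: "integrable lborel (indicator (gap_interval k) :: real \<Rightarrow> real)" for k
    by (cases "\<mu> k \<le> \<mu> (k+1)") (auto simp: gap_interval_def intro!: integrable_real_indicator)
  have W: "integrable lborel (w \<sigma>)" "(\<integral>x. w \<sigma> x \<partial>lborel) = P * \<sigma>\<^sup>2 + Q * \<sigma>" if "0 < \<sigma>" for \<sigma>
  proof -
    have 1: "integrable lborel (\<lambda>x. tail_const i * tail_const j * \<sigma>\<^sup>2 * \<rho> \<sigma> x)"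
      using integrable_\<rho>[OF that] by simp
    have 2: "integrable lborel (\<lambda>x. tail_const i * \<sigma> * indicator (gap_interval j) x)"
      "integrable lborel (\<lambda>x. tail_const j * \<sigma> * indicator (gap_interval i) x)"
      using gi by (auto intro!: integrable_mult_right)
    show "integrable lborel (w \<sigma>)" unfolding w_def using 1 2 by (intro Bochner_Integration.integrable_add)
    have m: "(\<integral>x. indicator (gap_interval k) x \<partial>lborel) = \<mu> (k+1) - \<mu> k" if "k \<in> {1..N-1}" for k
      using mean_less[OF that] by (simp add: gap_interval_def)
    have "(\<integral>x. w \<sigma> x \<partial>lborel) = tail_const i * tail_const j * \<sigma>\<^sup>2 * (\<integral>x. \<rho> \<sigma> x \<partial>lborel)
      + (tail_const i * \<sigma> * (\<integral>x. indicator (gap_interval j) x \<partial>lborel)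
        + tail_const j * \<sigma> * (\<integral>x. indicator (gap_interval i) x \<partial>lborel))"
      unfolding w_def Bochner_Integration.integral_add[OF 1 Bochner_Integration.integrable_add[OF 2]]
        Bochner_Integration.integral_add[OF 2] integral_mult_right_zero ..
    then show "(\<integral>x. w \<sigma> x \<partial>lborel) = P * \<sigma>\<^sup>2 + Q * \<sigma>"
      unfolding integral_\<rho>[OF that] m[OF assms(1)] m[OF assms(2)] P_def Q_def
      by (simp add: algebra_simps)
  qed
  have fw: "\<bar>f \<sigma> x\<bar> \<le> w \<sigma> x" if "0 < \<sigma>" for \<sigma> x
  proof (cases "x \<in> gap_interval i \<inter> gap_interval j")
    case True
    have "0 \<le> w \<sigma> x"
      using that assms(1,2) tail_const_nonneg \<rho>_pos[OF that, of x] unfolding w_def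
      by (intro add_nonneg_nonneg mult_nonneg_nonneg) auto
    with True show ?thesis by (simp add: f_def)
  next
    case False
    then show ?thesis using abs_integrand_outside[OF that assms(1,2) False] by (simp add: f_def w_def)
  qed
  show I: "integrable lborel (f \<sigma>)" if "0 < \<sigma>" for \<sigma>
    by (rule Bochner_Integration.integrable_bound[OF W(1)[OF that]])
       (use fw[OF that] in \<open>auto intro!: AE_I2 intro: order_trans[OF _ abs_ge_self]\<close>)
  have le: "\<bar>\<integral>x. f \<sigma> x \<partial>lborel\<bar> \<le> P * \<sigma>\<^sup>2 + Q * \<sigma>" if "0 < \<sigma>" for \<sigma>
  proof -
    have "\<bar>\<integral>x. f \<sigma> x \<partial>lborel\<bar> \<le> (\<integral>x. \<bar>f \<sigma> x\<bar> \<partial>lborel)" by simp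
    also have "\<dots> \<le> (\<integral>x. w \<sigma> x \<partial>lborel)"
      using fw[OF that] I[OF that] W[OF that] by (intro integral_mono) auto
    finally show ?thesis using W[OF that] by simp
  qed
  show "((\<lambda>\<sigma>. (\<integral>x. f \<sigma> x \<partial>lborel) / K_in d \<sigma>) \<longlongrightarrow> 0) (at_right 0)"
  proof (rule Lim_null_comparison)
    show "\<forall>\<^sub>F \<sigma> in at_right 0. norm ((\<integral>x. f \<sigma> x \<partial>lborel) / K_in d \<sigma>) \<le> (P * \<sigma>\<^sup>2 + Q * \<sigma>) / K_in d \<sigma>"
      using eventually_at_right_less
    proof eventually_elim
      case (elim \<sigma>)
      have "0 < K_in d \<sigma>" using elim d_pos by (simp add: K_in_def)
      then show ?case using le[OF elim] by (simp add: abs_mult divide_right_mono)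
    qed
    \<comment> \<open>The Gaussian exponential in \<open>K_in\<close> beats every power of
      \<open>1 / \<sigma>\<close>.\<close>
    have "((\<lambda>\<sigma>. P * (\<sigma>\<^sup>2 / K_in d \<sigma>) + Q * (\<sigma> / K_in d \<sigma>)) \<longlongrightarrow> P * 0 + Q * 0) (at_right 0)"
      unfolding K_in_def using d_pos by (intro tendsto_intros; real_asymp)
    then show "((\<lambda>\<sigma>. (P * \<sigma>\<^sup>2 + Q * \<sigma>) / K_in d \<sigma>) \<longlongrightarrow> 0) (at_right 0)"
      by (simp add: add_divide_distrib)
  qed
qed

subsection \<open>The mixture inside a gap\<close>

definition balance_point :: "nat \<Rightarrow> real" where
  "balance_point i = \<mu> i + d * s i"

text \<open>The prefactor times the Jacobian \<open>\<sigma>\<^sup>2 / d\<close> of the rescaling is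
  exactly \<open>K_in d \<sigma>\<close>, so dividing the integral by \<open>K_in\<close> leaves
  only \<open>scaled_\<rho>\<close> in the denominator.\<close>

definition scaled_\<rho> :: "nat \<Rightarrow> real \<Rightarrow> real \<Rightarrow> real" where
  "scaled_\<rho> i \<sigma> v = sqrt (2 * pi) * \<sigma> * exp ((d / \<sigma>)\<^sup>2 / 2) * \<rho> \<sigma> (balance_point i + \<sigma>\<^sup>2 / d * v)"

lemma balance_point_eq: "i \<in> {1..N-1} \<Longrightarrow> balance_point i = \<mu> (i+1) - d * s (i+1)"
  using gap[of i] by (simp add: balance_point_def algebra_simps)

text \<open>The balance point is the common endpoint of the intervals of radius \<open>d * s\<close>
  about the means \<open>i\<close> and \<open>i + 1\<close>. Every other such interval is separated
  from it by one of these two, whose positive width gives strictness.\<close>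

lemma balance_point_far:
  assumes "i \<in> {1..N-1}" "k \<in> {1..N}" "k \<noteq> i" "k \<noteq> i + 1"
  shows "d * s k < \<bar>balance_point i - \<mu> k\<bar>"
proof (cases "k < i")
  case True
  have "\<mu> k + d * s k \<le> \<mu> i - d * s i"
    using assms True by (intro mean_sep) auto
  moreover have "0 < d * s i" using assms d_pos s_pos component_indices by simp
  ultimately show ?thesis unfolding balance_point_def by linarith
next
  case False
  have "\<mu> (i+1) + d * s (i+1) \<le> \<mu> k - d * s k"
    using assms False by (intro mean_sep) auto
  moreover have "0 < d * s (i+1)" using component_indices[OF assms(1)] d_pos s_pos by simp
  ultimately show ?thesis unfolding balance_point_eq[OF assms(1)] by linarith
qed

text \<open>The balance point lies right of \<open>\<mu> i\<close> and left of
  \<open>\<mu> (i+1)\<close>, both at the critical distance, hence the opposite signs of the two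
  exponents.\<close>

lemma tendsto_scaled_components:
  assumes "i \<in> {1..N-1}"
  defines "R \<equiv> \<lambda>k v \<sigma>. sqrt (2 * pi) * \<sigma> * exp ((d / \<sigma>)\<^sup>2 / 2)
    * normal_density (\<mu> k) (s k * \<sigma>) (balance_point i + \<sigma>\<^sup>2 / d * v)"
  shows "(R i v \<longlongrightarrow> 1 / s i * exp (- (v / s i))) (at_right 0)"
    and "(R (i+1) v \<longlongrightarrow> 1 / s (i+1) * exp (v / s (i+1))) (at_right 0)"
    and "k \<in> {1..N} \<Longrightarrow> k \<noteq> i \<Longrightarrow> k \<noteq> i + 1 \<Longrightarrow> (R k v \<longlongrightarrow> 0) (at_right 0)"
proof -
  note idx = component_indices[OF assms(1)]
  have sp: "0 < d * s i" "0 < d * s (i+1)" using idx d_pos s_pos by simp_all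
  have 1: "balance_point i - \<mu> i = d * s i" by (simp add: balance_point_def)
  show "(R i v \<longlongrightarrow> 1 / s i * exp (- (v / s i))) (at_right 0)"
    using tendsto_scaled_normal_density[of d "s i" "balance_point i" "\<mu> i" v] sp d_pos s_pos[OF idx(1)]
    unfolding R_def 1 by simp
  have 2: "balance_point i - \<mu> (i+1) = - (d * s (i+1))" by (simp add: balance_point_eq[OF assms(1)])
  show "(R (i+1) v \<longlongrightarrow> 1 / s (i+1) * exp (v / s (i+1))) (at_right 0)"
    using tendsto_scaled_normal_density[of d "s (i+1)" "balance_point i" "\<mu> (i+1)" v] sp d_pos s_pos[OF idx(2)]
    unfolding R_def 2 sgn_minus sgn_pos[OF sp(2)] abs_minus_cancel abs_of_pos[OF sp(2)] by simp
  show "k \<in> {1..N} \<Longrightarrow> k \<noteq> i \<Longrightarrow> k \<noteq> i + 1 \<Longrightarrow> (R k v \<longlongrightarrow> 0) (at_right 0)"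
    unfolding R_def using d_pos s_pos balance_point_far[OF assms(1)]
    by (intro tendsto_scaled_normal_density_0)
qed

lemma scaled_\<rho>_eq:
  "scaled_\<rho> i \<sigma> v = (\<Sum>k=1..N. p k * (sqrt (2 * pi) * \<sigma> * exp ((d / \<sigma>)\<^sup>2 / 2)
    * normal_density (\<mu> k) (s k * \<sigma>) (balance_point i + \<sigma>\<^sup>2 / d * v)))"
  unfolding scaled_\<rho>_def \<rho>_eq sum_distrib_left by (simp add: mult_ac)

lemma tendsto_scaled_\<rho>:
  assumes "i \<in> {1..N-1}"
  shows "((\<lambda>\<sigma>. scaled_\<rho> i \<sigma> v)
    \<longlongrightarrow> p i / s i * exp (- (v / s i)) + p (i+1) / s (i+1) * exp (v / s (i+1))) (at_right 0)"
proof -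
  \<comment> \<open>Written as two delta terms, so that the sum picks out the entries at
    \<open>i\<close> and \<open>i + 1\<close>.\<close>
  define L where "L k = (if k = i then p i / s i * exp (- (v / s i)) else 0)
    + (if k = i + 1 then p (i+1) / s (i+1) * exp (v / s (i+1)) else 0)" for k
  note idx = component_indices[OF assms(1)]
  have "((\<lambda>\<sigma>. scaled_\<rho> i \<sigma> v) \<longlongrightarrow> (\<Sum>k=1..N. L k)) (at_right 0)"
    unfolding scaled_\<rho>_eq
  proof (rule tendsto_sum)
    fix k assume k: "k \<in> {1..N}"
    consider "k = i" | "k = i + 1" | "k \<noteq> i" "k \<noteq> i + 1" by blast
    then show "((\<lambda>\<sigma>. p k * (sqrt (2 * pi) * \<sigma> * exp ((d / \<sigma>)\<^sup>2 / 2)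
        * normal_density (\<mu> k) (s k * \<sigma>) (balance_point i + \<sigma>\<^sup>2 / d * v))) \<longlongrightarrow> L k) (at_right 0)"
    proof cases
      case 1
      show ?thesis
        using tendsto_mult_left[OF tendsto_scaled_components(1)[OF assms], of "p i" v]
        unfolding 1 L_def by simp
    next
      case 2
      show ?thesis
        using tendsto_mult_left[OF tendsto_scaled_components(2)[OF assms], of "p (i+1)" v]
        unfolding 2 L_def by simp
    next
      case 3
      show ?thesis
        using tendsto_mult_left[OF tendsto_scaled_components(3)[OF assms k 3], of "p k" v] 3
        unfolding L_def by simp
    qed
  qed
  also have "(\<Sum>k=1..N. L k) = p i / s i * exp (- (v / s i)) + p (i+1) / s (i+1) * exp (v / s (i+1))"
    unfolding L_def sum.distrib using idx by (simp add: sum.delta)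
  finally show ?thesis .
qed

lemma scaled_\<rho>_ge_component:
  assumes "0 < \<sigma>" "k \<in> {1..N}"
  shows "p k / s k * exp ((d\<^sup>2 - ((balance_point i - \<mu> k) / s k)\<^sup>2) / (2 * \<sigma>\<^sup>2)
      - (balance_point i - \<mu> k) * v / (d * (s k)\<^sup>2) - \<sigma>\<^sup>2 * v\<^sup>2 / (2 * d\<^sup>2 * (s k)\<^sup>2)) \<le> scaled_\<rho> i \<sigma> v"
proof -
  have "p k * (sqrt (2 * pi) * \<sigma> * exp ((d / \<sigma>)\<^sup>2 / 2)
      * normal_density (\<mu> k) (s k * \<sigma>) (balance_point i + \<sigma>\<^sup>2 / d * v)) \<le> scaled_\<rho> i \<sigma> v"
    unfolding scaled_\<rho>_def mult.left_commute[of "p k"]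
    using assms by (intro mult_left_mono \<rho>_ge) auto
  then show ?thesis
    unfolding scaled_normal_density[OF assms(1) d_pos s_pos[OF assms(2)]] by simp
qed

text \<open>Keep component \<open>i\<close> for \<open>v \<le> 0\<close> and component
  \<open>i + 1\<close> otherwise, the one that grows with \<open>\<bar>v\<bar>\<close>. Inside the
  gap its mean has not been passed, so \<open>half_exponent_bound\<close> retains half of the linear
  rate. The minorant is independent of \<sigma>, as dominated convergence requires.\<close>

lemma scaled_\<rho>_ge:
  assumes "0 < \<sigma>" "i \<in> {1..N-1}" "balance_point i + \<sigma>\<^sup>2 / d * v \<in> gap_interval i"
  shows "min (p i / s i) (p (i+1) / s (i+1)) * exp (min (1 / (2 * s i)) (1 / (2 * s (i+1))) * \<bar>v\<bar>)
    \<le> scaled_\<rho> i \<sigma> v"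
proof (cases "v \<le> 0")
  case True
  note idx = component_indices[OF assms(2)]
  note sp = s_pos[OF idx(1)] s_pos[OF idx(2)] p_pos[OF idx(1)] p_pos[OF idx(2)]
  have "\<sigma>\<^sup>2 / d * (- v) \<le> d * s i"
    using assms(3) by (simp add: gap_interval_def balance_point_def)
  then have *: "- v / (2 * s i) \<le> - v / s i - \<sigma>\<^sup>2 * (- v)\<^sup>2 / (2 * d\<^sup>2 * (s i)\<^sup>2)"
    using True sp d_pos by (intro half_exponent_bound) auto
  have "min (p i / s i) (p (i+1) / s (i+1)) * exp (min (1 / (2 * s i)) (1 / (2 * s (i+1))) * \<bar>v\<bar>)
      \<le> p i / s i * exp (1 / (2 * s i) * \<bar>v\<bar>)"
    using sp by (intro mult_mono iffD2[OF exp_le_cancel_iff]) auto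
  also have "\<dots> \<le> p i / s i * exp (- v / s i - \<sigma>\<^sup>2 * v\<^sup>2 / (2 * d\<^sup>2 * (s i)\<^sup>2))"
    using * True sp by (intro mult_left_mono) auto
  \<comment> \<open>At the balance point the constant part of the exponent of component
    \<open>i\<close> vanishes.\<close>
  also have "\<dots> \<le> scaled_\<rho> i \<sigma> v"
    using scaled_\<rho>_ge_component[OF assms(1) idx(1), of i v] sp d_pos
    by (simp add: balance_point_def power2_eq_square)
  finally show ?thesis .
next
  case False
  note idx = component_indices[OF assms(2)]
  note sp = s_pos[OF idx(1)] s_pos[OF idx(2)] p_pos[OF idx(1)] p_pos[OF idx(2)]
  have "\<sigma>\<^sup>2 / d * v \<le> d * s (i+1)"
    using assms(3) by (simp add: gap_interval_def balance_point_eq[OF assms(2)])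
  then have *: "v / (2 * s (i+1)) \<le> v / s (i+1) - \<sigma>\<^sup>2 * v\<^sup>2 / (2 * d\<^sup>2 * (s (i+1))\<^sup>2)"
    using False sp d_pos by (intro half_exponent_bound) auto
  have "min (p i / s i) (p (i+1) / s (i+1)) * exp (min (1 / (2 * s i)) (1 / (2 * s (i+1))) * \<bar>v\<bar>)
      \<le> p (i+1) / s (i+1) * exp (1 / (2 * s (i+1)) * \<bar>v\<bar>)"
    using sp by (intro mult_mono iffD2[OF exp_le_cancel_iff]) auto
  also have "\<dots> \<le> p (i+1) / s (i+1) * exp (v / s (i+1) - \<sigma>\<^sup>2 * v\<^sup>2 / (2 * d\<^sup>2 * (s (i+1))\<^sup>2))"
    using * False sp by (intro mult_left_mono) auto
  also have "\<dots> \<le> scaled_\<rho> i \<sigma> v"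
    using scaled_\<rho>_ge_component[OF assms(1) idx(2), of i v] sp d_pos
    by (simp add: balance_point_eq[OF assms(2)] power2_eq_square)
  finally show ?thesis .
qed

section \<open>Pointwise limits and dominated convergence inside a gap\<close>

lemma eventually_in_gap_interval:
  assumes "i \<in> {1..N-1}"
  shows "\<forall>\<^sub>F \<sigma> in at_right 0. balance_point i + \<sigma>\<^sup>2 / d * v \<in> gap_interval i"
proof -
  note idx = component_indices[OF assms(1)]
  have sp: "0 < d * s i" "0 < d * s (i+1)" using idx d_pos s_pos by simp_all
  have "((\<lambda>\<sigma>. balance_point i + \<sigma>\<^sup>2 / d * v) \<longlongrightarrow> balance_point i + 0\<^sup>2 / d * v) (at_right 0)"
    using d_pos by (intro tendsto_intros) auto
  moreover have "balance_point i + 0\<^sup>2 / d * v \<in> gap_interval i"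
    using sp balance_point_def[of i] balance_point_eq[OF assms] by (simp add: gap_interval_def)
  ultimately show ?thesis
    unfolding tendsto_def by (auto simp: gap_interval_def)
qed

lemma tendsto_dF_balance_point:
  assumes "i \<in> {1..N-1}"
  shows "((\<lambda>\<sigma>. dF \<sigma> i (balance_point i + \<sigma>\<^sup>2 / d * v)) \<longlongrightarrow> -1) (at_right 0)"
proof -
  note idx = component_indices[OF assms(1)]
  define x where "x \<sigma> = balance_point i + \<sigma>\<^sup>2 / d * v" for \<sigma>
  define T where "T k \<sigma> = sqrt (2 * pi) * (s k * \<sigma>) * normal_density (\<mu> k) (s k * \<sigma>) (x \<sigma>)" for k \<sigma>
  \<comment> \<open>\<open>T k\<close> is the rescaled density, which converges, times
    \<open>s k\<close> and the inverse of the large exponential.\<close>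
  have T0: "(T k \<longlongrightarrow> 0) (at_right 0)"
    if "((\<lambda>\<sigma>. sqrt (2 * pi) * \<sigma> * exp ((d / \<sigma>)\<^sup>2 / 2) * normal_density (\<mu> k) (s k * \<sigma>) (x \<sigma>))
      \<longlongrightarrow> L) (at_right 0)" for k L
  proof -
    have "((\<lambda>\<sigma>. exp (- (d / \<sigma>)\<^sup>2 / 2)) \<longlongrightarrow> 0) (at_right 0)"
      using d_pos by real_asymp
    then have "((\<lambda>\<sigma>. s k * exp (- (d / \<sigma>)\<^sup>2 / 2) * (sqrt (2 * pi) * \<sigma> * exp ((d / \<sigma>)\<^sup>2 / 2)
        * normal_density (\<mu> k) (s k * \<sigma>) (x \<sigma>))) \<longlongrightarrow> s k * 0 * L) (at_right 0)"
      using that by (intro tendsto_intros)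
    moreover have "s k * exp (- (d / \<sigma>)\<^sup>2 / 2) * (sqrt (2 * pi) * \<sigma> * exp ((d / \<sigma>)\<^sup>2 / 2)
        * normal_density (\<mu> k) (s k * \<sigma>) (x \<sigma>)) = T k \<sigma>" for \<sigma>
      unfolding T_def by (simp add: exp_minus field_simps)
    ultimately show ?thesis by simp
  qed
  have T: "((\<lambda>\<sigma>. T i \<sigma> + T (i+1) \<sigma>) \<longlongrightarrow> 0) (at_right 0)"
    using tendsto_add[OF T0 T0] tendsto_scaled_components(1,2)[OF assms]
    unfolding x_def by fastforce
  have "((\<lambda>\<sigma>. dF \<sigma> i (x \<sigma>) + 1) \<longlongrightarrow> 0) (at_right 0)"
  proof (rule Lim_null_comparison[OF _ T])
    \<comment> \<open>Between the two means, \<open>dF + 1\<close> is the lower tail of component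
      \<open>i + 1\<close> plus the upper tail of component \<open>i\<close>.\<close>
    show "\<forall>\<^sub>F \<sigma> in at_right 0. norm (dF \<sigma> i (x \<sigma>) + 1) \<le> T i \<sigma> + T (i+1) \<sigma>"
      using eventually_at_right_less eventually_in_gap_interval[OF assms, of v]
    proof eventually_elim
      case (elim \<sigma>)
      have sk: "0 < s i * \<sigma>" "0 < s (i+1) * \<sigma>" using idx elim s_pos by simp_all
      have x: "\<mu> i \<le> x \<sigma>" "x \<sigma> \<le> \<mu> (i+1)" using elim by (auto simp: gap_interval_def x_def)
      show ?case
        using gauss_cdf_upper_tail[OF sk(1) x(1)] gauss_cdf_lower_tail[OF sk(2) x(2)]
          gauss_cdf_bounds[OF sk(1), of "\<mu> i" "x \<sigma>"] gauss_cdf_bounds[OF sk(2), of "\<mu> (i+1)" "x \<sigma>"]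
        unfolding dF_def T_def by auto
    qed
  qed
  from tendsto_add[OF this tendsto_const[of "-1"]] show ?thesis by (simp add: x_def)
qed

lemma inside_integral:
  assumes "i \<in> {1..N-1}"
  defines "f \<equiv> \<lambda>\<sigma> x. indicator (gap_interval i) x * integrand i i \<sigma> x"
  shows "0 < \<sigma> \<Longrightarrow> integrable lborel (f \<sigma>)"
    and "((\<lambda>\<sigma>. (\<integral>x. f \<sigma> x \<partial>lborel) / K_in d \<sigma>) \<longlongrightarrow>
      (\<integral>v. 1 / (p i / s i * exp (- (v / s i)) + p (i+1) / s (i+1) * exp (v / s (i+1))) \<partial>lborel)) (at_right 0)"
proof -
  note idx = component_indices[OF assms(1)]
  note sp = s_pos[OF idx(1)] s_pos[OF idx(2)] p_pos[OF idx(1)] p_pos[OF idx(2)]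
  define x where "x \<sigma> v = balance_point i + \<sigma>\<^sup>2 / d * v" for \<sigma> v
  \<comment> \<open>The \<sigma>-dependent range of \<open>v\<close> is encoded by the indicator, so
    all integrals run over the whole line.\<close>
  define h where "h \<sigma> v = indicator (gap_interval i) (x \<sigma> v) * (dF \<sigma> i (x \<sigma> v))\<^sup>2 / scaled_\<rho> i \<sigma> v" for \<sigma> v
  define \<alpha> where "\<alpha> = min (p i / s i) (p (i+1) / s (i+1))"
  define \<kappa> where "\<kappa> = min (1 / (2 * s i)) (1 / (2 * s (i+1)))"
  \<comment> \<open>Majorant for every \<sigma>: \<open>scaled_\<rho>_ge\<close> bounds the
    denominator from below and \<open>dF\<close> has modulus at most 1.\<close>
  define w where "w v = exp (- \<kappa> * \<bar>v\<bar>) / \<alpha>" for v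
  have pos: "0 < \<alpha>" "0 < \<kappa>" using sp by (auto simp: \<alpha>_def \<kappa>_def)
  have [measurable]: "gap_interval i \<in> sets borel" by (simp add: gap_interval_def)
  have h_meas [measurable]: "h \<sigma> \<in> borel_measurable lborel" for \<sigma>
    unfolding h_def x_def scaled_\<rho>_def by measurable
  have w_int: "integrable lborel w"
    unfolding w_def using pos by (intro integrable_divide integrable_exp_neg_abs)
  have bound: "norm (h \<sigma> v) \<le> w v" if "0 < \<sigma>" for \<sigma> v
  proof (cases "x \<sigma> v \<in> gap_interval i")
    case True
    have "\<alpha> * exp (\<kappa> * \<bar>v\<bar>) \<le> scaled_\<rho> i \<sigma> v"
      using scaled_\<rho>_ge[OF that assms(1)] True unfolding \<alpha>_def \<kappa>_def x_def by blast
    moreover have "(dF \<sigma> i (x \<sigma> v))\<^sup>2 \<le> 1"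
      using abs_dF_le_1[OF that assms(1)] by (simp add: abs_square_le_1)
    moreover have "0 < \<alpha> * exp (\<kappa> * \<bar>v\<bar>)" using pos by simp
    ultimately have "(dF \<sigma> i (x \<sigma> v))\<^sup>2 / scaled_\<rho> i \<sigma> v \<le> 1 / (\<alpha> * exp (\<kappa> * \<bar>v\<bar>))"
      and "0 < scaled_\<rho> i \<sigma> v"
      by (auto intro: frac_le)
    with True show ?thesis by (simp add: h_def w_def exp_minus field_simps)
  qed (use pos in \<open>simp add: h_def w_def\<close>)
  have h_int: "integrable lborel (h \<sigma>)" if "0 < \<sigma>" for \<sigma>
    by (rule Bochner_Integration.integrable_bound[OF w_int])
       (use bound[OF that] in \<open>auto intro!: AE_I2 intro: order_trans[OF _ abs_ge_self]\<close>)
  have f_h: "f \<sigma> (x \<sigma> v) = sqrt (2 * pi) * \<sigma> * exp ((d / \<sigma>)\<^sup>2 / 2) * h \<sigma> v" if "0 < \<sigma>" for \<sigma> v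
    using that unfolding f_def h_def integrand_def scaled_\<rho>_def x_def[symmetric]
    by (simp add: power2_eq_square)
  show "integrable lborel (f \<sigma>)" if "0 < \<sigma>" for \<sigma>
  proof -
    have "integrable lborel (\<lambda>v. f \<sigma> (x \<sigma> v))"
      unfolding f_h[OF that] using h_int[OF that] by simp
    then show ?thesis
      using that d_pos lborel_integrable_real_affine_iff[of "\<sigma>\<^sup>2 / d" "f \<sigma>" "balance_point i"]
      unfolding x_def by simp
  qed
  have f_int: "(\<integral>x. f \<sigma> x \<partial>lborel) / K_in d \<sigma> = (\<integral>v. h \<sigma> v \<partial>lborel)" if "0 < \<sigma>" for \<sigma>
  proof -
    have "(\<integral>x. f \<sigma> x \<partial>lborel) = \<sigma>\<^sup>2 / d * (\<integral>v. f \<sigma> (x \<sigma> v) \<partial>lborel)"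
      using that d_pos lborel_integral_real_affine[of "\<sigma>\<^sup>2 / d" "f \<sigma>" "balance_point i"]
      unfolding x_def by simp
    also have "\<dots> = K_in d \<sigma> * (\<integral>v. h \<sigma> v \<partial>lborel)"
      unfolding f_h[OF that] by (simp add: K_in_def power2_eq_square power3_eq_cube)
    finally show ?thesis using that d_pos by (simp add: K_in_def)
  qed
  \<comment> \<open>With \<open>\<sigma> = inverse t\<close>, the limit at 0 from the right becomes
    one at infinity.\<close>
  have "((\<lambda>t. \<integral>v. h (inverse t) v \<partial>lborel) \<longlongrightarrow>
      (\<integral>v. 1 / (p i / s i * exp (- (v / s i)) + p (i+1) / s (i+1) * exp (v / s (i+1))) \<partial>lborel)) at_top"
  proof (rule integral_dominated_convergence_at_top)
    show "AE v in lborel. ((\<lambda>t. h (inverse t) v)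
      \<longlongrightarrow> 1 / (p i / s i * exp (- (v / s i)) + p (i+1) / s (i+1) * exp (v / s (i+1)))) at_top"
    proof (rule AE_I2)
      fix v
      have "0 < p i / s i * exp (- (v / s i)) + p (i+1) / s (i+1) * exp (v / s (i+1))"
        using sp by (intro add_pos_pos) auto
      moreover have "((\<lambda>\<sigma>. indicator (gap_interval i) (x \<sigma> v) :: real) \<longlongrightarrow> 1) (at_right 0)"
        using eventually_in_gap_interval[OF assms(1), of v]
        by (intro tendsto_eventually) (auto simp: x_def elim: eventually_mono)
      moreover have "((\<lambda>\<sigma>. dF \<sigma> i (x \<sigma> v)) \<longlongrightarrow> -1) (at_right 0)"
        unfolding x_def by (rule tendsto_dF_balance_point[OF assms(1)])
      ultimately have "((\<lambda>\<sigma>. h \<sigma> v) \<longlongrightarrow> 1 * (-1)\<^sup>2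
          / (p i / s i * exp (- (v / s i)) + p (i+1) / s (i+1) * exp (v / s (i+1)))) (at_right 0)"
        unfolding h_def
        by (intro tendsto_divide tendsto_mult tendsto_power tendsto_scaled_\<rho>[OF assms(1)]) auto
      then show "((\<lambda>t. h (inverse t) v)
        \<longlongrightarrow> 1 / (p i / s i * exp (- (v / s i)) + p (i+1) / s (i+1) * exp (v / s (i+1)))) at_top"
        by (simp add: filterlim_at_right_to_top)
    qed
    show "\<forall>\<^sub>F t in at_top. AE v in lborel. norm (h (inverse t) v) \<le> w v"
      using eventually_gt_at_top[of 0] by eventually_elim (intro AE_I2 bound, simp)
  qed (use w_int in measurable)
  then have "((\<lambda>\<sigma>. \<integral>v. h \<sigma> v \<partial>lborel) \<longlongrightarrow>
      (\<integral>v. 1 / (p i / s i * exp (- (v / s i)) + p (i+1) / s (i+1) * exp (v / s (i+1))) \<partial>lborel)) (at_right 0)"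
    by (simp add: filterlim_at_right_to_top)
  then show "((\<lambda>\<sigma>. (\<integral>x. f \<sigma> x \<partial>lborel) / K_in d \<sigma>) \<longlongrightarrow>
      (\<integral>v. 1 / (p i / s i * exp (- (v / s i)) + p (i+1) / s (i+1) * exp (v / s (i+1))) \<partial>lborel)) (at_right 0)"
    by (rule Lim_transform_eventually)
       (rule eventually_mono[OF eventually_at_right_less f_int[symmetric]])
qed

section \<open>Assembling the entries of the matrix\<close>

theorem wasserstein_info_matrix_limit:
  assumes i: "i \<in> {1..N-1}" and j: "j \<in> {1..N-1}"
  shows "((\<lambda>\<sigma>. wasserstein_info_matrix N \<mu> (\<lambda>k. s k * \<sigma>) \<theta> i j / K_in d \<sigma>) \<longlongrightarrow>
      (if i = j then 1 else 0) * g_in (s (i+1) / s i)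
        * (s (i+1) / p (i+1)) powr (s (i+1) / (s (i+1) + s i))
        * (s i / p i) powr (s i / (s (i+1) + s i))
        * s i) (at_right 0)"
proof (cases "i = j")
  case False
  \<comment> \<open>With disjoint gaps the complement of their intersection is the whole line, so
    the negligible outside integral is the entire entry.\<close>
  then have "gap_interval i \<inter> gap_interval j = {}"
    using gap_interval_disjoint[OF i j] gap_interval_disjoint[OF j i] by (cases "i < j") auto
  then show ?thesis
    using outside_integral(2)[OF i j] False by (simp add: wasserstein_info_matrix_eq)
next
  case True
  define fo where "fo \<sigma> x = indicator (- gap_interval i) x * integrand i i \<sigma> x" for \<sigma> x
  define fi where "fi \<sigma> x = indicator (gap_interval i) x * integrand i i \<sigma> x" for \<sigma> x
  define L where "L = (\<integral>v. 1 / (p i / s i * exp (- (v / s i)) + p (i+1) / s (i+1) * exp (v / s (i+1))) \<partial>lborel)"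
  \<comment> \<open>Both pieces are integrable, so the diagonal entry is the sum of its parts inside
    and outside the gap.\<close>
  have split: "(\<integral>x. fi \<sigma> x \<partial>lborel) / K_in d \<sigma> + (\<integral>x. fo \<sigma> x \<partial>lborel) / K_in d \<sigma>
      = (\<integral>x. integrand i i \<sigma> x \<partial>lborel) / K_in d \<sigma>" if "0 < \<sigma>" for \<sigma>
  proof -
    have "(\<integral>x. fi \<sigma> x \<partial>lborel) + (\<integral>x. fo \<sigma> x \<partial>lborel) = (\<integral>x. fi \<sigma> x + fo \<sigma> x \<partial>lborel)"
      using inside_integral(1)[OF i that] outside_integral(1)[OF i i that]
      by (intro Bochner_Integration.integral_add[symmetric]) (simp_all add: fi_def fo_def)
    also have "\<dots> = (\<integral>x. integrand i i \<sigma> x \<partial>lborel)"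
      by (intro Bochner_Integration.integral_cong) (auto simp: fi_def fo_def split: split_indicator)
    finally show ?thesis by (simp flip: add_divide_distrib)
  qed
  have "((\<lambda>\<sigma>. (\<integral>x. fi \<sigma> x \<partial>lborel) / K_in d \<sigma> + (\<integral>x. fo \<sigma> x \<partial>lborel) / K_in d \<sigma>) \<longlongrightarrow> L + 0) (at_right 0)"
    using inside_integral(2)[OF i] outside_integral(2)[OF i i]
    by (intro tendsto_add) (simp_all add: fi_def fo_def L_def)
  then have "((\<lambda>\<sigma>. (\<integral>x. integrand i i \<sigma> x \<partial>lborel) / K_in d \<sigma>) \<longlongrightarrow> L + 0) (at_right 0)"
    by (rule Lim_transform_eventually)
       (rule eventually_mono[OF eventually_at_right_less split])
  \<comment> \<open>Here \<open>a = p i / s i\<close> and \<open>b = p (i+1) / s (i+1)\<close>;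
    their reciprocals give the bases of the powers.\<close>
  moreover have "L = g_in (s (i+1) / s i) * (s (i+1) / p (i+1)) powr (s (i+1) / (s (i+1) + s i))
        * (s i / p i) powr (s i / (s (i+1) + s i)) * s i"
    using integral_inverse_exp_sum[of "p i / s i" "p (i+1) / s (i+1)" "s i" "s (i+1)"]
      component_indices[OF i] s_pos p_pos by (simp add: L_def)
  ultimately show ?thesis
    using True by (simp add: wasserstein_info_matrix_eq)
qed

end

theorem theorem4:
  fixes N :: nat and \<mu> gap s \<theta> :: "nat \<Rightarrow> real" and d :: real
  assumes N: "N \<ge> 2"
    and gaps: "\<And>i. i \<in> {1..N-1} \<Longrightarrow> \<mu> (i+1) - \<mu> i = gap i"
    and gaps_pos: "\<And>i. i \<in> {1..N-1} \<Longrightarrow> gap i > 0"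
    and s_pos: "\<And>i. i \<in> {1..N} \<Longrightarrow> s i > 0"
    and d_pos: "d > 0"
    and ratio: "\<And>i. i \<in> {1..N-1} \<Longrightarrow> gap i / (s i + s (i+1)) = d"
    and theta_0: "\<theta> 0 = 1"
    and theta_N: "\<theta> N = 0"
    and theta_decr: "\<And>i. i \<in> {1..N} \<Longrightarrow> \<theta> i < \<theta> (i-1)"
    and i: "i \<in> {1..N-1}"
    and j: "j \<in> {1..N-1}"
  shows "((\<lambda>\<sigma>. wasserstein_info_matrix N \<mu> (\<lambda>k. s k * \<sigma>) \<theta> i j / K_in d \<sigma>) \<longlongrightarrow>
      (if i = j then 1 else 0) * g_in (s (i+1) / s i)
        * (s (i+1) / mixture_weight \<theta> (i+1)) powr (s (i+1) / (s (i+1) + s i))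
        * (s i / mixture_weight \<theta> i) powr (s i / (s (i+1) + s i))
        * s i) (at_right 0)"
proof -
  interpret gaussian_mixture N \<mu> s \<theta> d
  proof
    fix k assume k: "k \<in> {1..N-1}"
    \<comment> \<open>The common ratio can be multiplied out because its denominator is
      nonzero.\<close>
    have "0 < s k + s (k+1)" using k s_pos[of k] s_pos[of "k+1"] by (intro add_pos_pos) auto
    then show "\<mu> (k+1) - \<mu> k = d * (s k + s (k+1))"
      unfolding gaps[OF k] ratio[OF k, symmetric] by simp
  qed (use N s_pos d_pos theta_0 theta_N theta_decr in auto)
  show ?thesis using i j by (rule wasserstein_info_matrix_limit)
qed

end
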